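(* For integers $k\ge 4$ and $n\ge 2$, let $G_{k,n}$ be the graph obtained from the complete graph $K_k$ by replacing every edge with $n$ internally disjoint paths of length $2$ (i.e., for each pair $x_i,x_j$ of original vertices, $n$ new vertices each adjacent exactly to $x_i$ and $x_j$), and then adding one further vertex adjacent to all other vertices. Then $$\mathrm{sg}(G_{k,n}) = \binom{k}{2} (n-1) + k \quad \text{and} \quad \mathrm{sg}(G_{k,n} \,\square\, K_n) \leq k n + 1.$$
   Context: $\square$ denotes the Cartesian product (vertex set $V(G)\times V(H)$, $(g,h)\sim(g',h')$ iff either $g=g'$ and $hh'\in E(H)$, or $h=h'$ and $gg'\in E(G)$). For a connected graph $G$ and $S\subseteq V(G)$, $S$ is a strong geodetic set if one can fix, for each unordered pair of distinct $x,y\in S$, a single shortest $x,y$-path so that the union of the vertex sets of the chosen paths is $V(G)$; $\mathrm{sg}(G)$ is the minimum size of a strong geodetic set. *)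

theory Defs
  imports "Graph_Theory.Graph_Theory"
begin

text \<open>
  A finite simple graph is a value of type \<^typ>\<open>'a pair_pre_digraph\<close> satisfying
  \<^locale>\<open>pair_graph\<close>: each edge is present as the two opposite arcs.
\<close>

definition shortest_vpath :: "'a pair_pre_digraph \<Rightarrow> 'a \<Rightarrow> 'a \<Rightarrow> 'a vwalk \<Rightarrow> bool" where
  "shortest_vpath G x y p \<longleftrightarrow>
     vpath p (with_proj G) \<and> hd p = x \<and> last p = y \<and>
     (\<forall>q. vpath q (with_proj G) \<and> hd q = x \<and> last q = y \<longrightarrow> vwalk_length p \<le> vwalk_length q)"

text \<open>
  \<open>P\<close> takes the unordered pair as its argument, so that one path is fixed per pair; the
  disjunction lets that path be listed from either of its two ends. On a one-vertex
  graph there are no pairs, so no set is strong geodetic in this reading.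
\<close>

definition strong_geodetic_set :: "'a pair_pre_digraph \<Rightarrow> 'a set \<Rightarrow> bool" where
  "strong_geodetic_set G S \<longleftrightarrow>
     S \<subseteq> pverts G \<and>
     (\<exists>P :: 'a set \<Rightarrow> 'a vwalk.
        (\<forall>x\<in>S. \<forall>y\<in>S. x \<noteq> y \<longrightarrow>
           shortest_vpath G x y (P {x, y}) \<or> shortest_vpath G y x (P {x, y})) \<and>
        (\<Union>e\<in>{{x, y} |x y. x \<in> S \<and> y \<in> S \<and> x \<noteq> y}. set (P e)) = pverts G)"

definition strong_geodetic_number :: "'a pair_pre_digraph \<Rightarrow> nat" where
  "strong_geodetic_number G =
     (LEAST m. \<exists>S. finite S \<and> strong_geodetic_set G S \<and> card S = m)"

definition cartesian_product ::
    "'a pair_pre_digraph \<Rightarrow> 'b pair_pre_digraph \<Rightarrow> ('a \<times> 'b) pair_pre_digraph"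
    (infixr \<open>\<box>\<close> 70) where
  "G \<box> H =
     \<lparr> pverts = pverts G \<times> pverts H,
       parcs = {((g, h), (g', h')) |g h g' h'.
         (g = g' \<and> g \<in> pverts G \<and> (h, h') \<in> parcs H) \<or>
         (h = h' \<and> h \<in> pverts H \<and> (g, g') \<in> parcs G)} \<rparr>"

definition complete_graph :: "nat \<Rightarrow> nat pair_pre_digraph" where
  "complete_graph n = \<lparr> pverts = {..<n}, parcs = {(i, j). i < n \<and> j < n \<and> i \<noteq> j} \<rparr>"

text \<open>
  \<open>Mid i j l\<close> is the middle vertex of the \<open>l\<close>-th path that replaces the edge between
  \<open>Orig i\<close> and \<open>Orig j\<close>; it is used only for \<open>i < j\<close>, so that each edge of the complete
  graph is counted once.
\<close>

datatype sub_vert = Orig nat | Mid nat nat nat | Apex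

definition sub_verts :: "nat \<Rightarrow> nat \<Rightarrow> sub_vert set" where
  "sub_verts k n = {Orig i |i. i < k} \<union> {Mid i j l |i j l. i < j \<and> j < k \<and> l < n}"

definition sub_arcs :: "nat \<Rightarrow> nat \<Rightarrow> sub_vert rel" where
  "sub_arcs k n =
     {(Orig i, Mid i j l) |i j l. i < j \<and> j < k \<and> l < n} \<union>
     {(Orig j, Mid i j l) |i j l. i < j \<and> j < k \<and> l < n}"

definition cone_graph :: "nat \<Rightarrow> nat \<Rightarrow> sub_vert pair_pre_digraph" where
  "cone_graph k n =
     \<lparr> pverts = insert Apex (sub_verts k n),
       parcs = (let A = sub_arcs k n \<union> {Apex} \<times> sub_verts k n in A \<union> A\<inverse>) \<rparr>"

lemma pair_graphI:
  assumes "finite (pverts G)" "parcs G \<subseteq> pverts G \<times> pverts G" "irrefl (parcs G)" "sym (parcs G)"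
  shows "pair_graph G"
proof -
  have "finite (parcs G)"
    using assms(1,2) by (meson finite_SigmaI finite_subset)
  with assms show ?thesis
    by unfold_locales (auto simp: irrefl_def symmetric_def)
qed

lemma pair_graph_complete: "pair_graph (complete_graph n)"
  by (rule pair_graphI) (auto simp: complete_graph_def irrefl_def sym_def)

lemma complete_graph_is_complete: "complete_digraph n (with_proj (complete_graph n))"
proof -
  interpret pair_graph "complete_graph n" by (rule pair_graph_complete)
  show ?thesis
    using graph_axioms unfolding complete_digraph_def by (auto simp: complete_graph_def)
qed

lemma finite_sub_verts: "finite (sub_verts k n)"
proof -
  have "sub_verts k n \<subseteq> Orig ` {..<k} \<union> (\<lambda>(i, j, l). Mid i j l) ` ({..<k} \<times> {..<k} \<times> {..<n})"
    by (auto simp: sub_verts_def image_iff)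
  then show ?thesis by (rule finite_subset) auto
qed

lemma pair_graph_cone: "pair_graph (cone_graph k n)"
proof (rule pair_graphI)
  show "finite (pverts (cone_graph k n))"
    by (simp add: cone_graph_def finite_sub_verts)
qed (auto simp: cone_graph_def sub_arcs_def sub_verts_def irrefl_def sym_def Let_def)

lemma pair_graph_cartesian:
  assumes "pair_graph G" "pair_graph H"
  shows "pair_graph (G \<box> H)"
proof -
  interpret G: pair_graph G by fact
  interpret H: pair_graph H by fact
  show ?thesis
  proof (rule pair_graphI)
    show "finite (pverts (G \<box> H))"
      using G.finite_verts H.finite_verts by (simp add: cartesian_product_def)
    show "parcs (G \<box> H) \<subseteq> pverts (G \<box> H) \<times> pverts (G \<box> H)"
      by (auto simp: cartesian_product_def dest: G.in_arcsD1 G.in_arcsD2 H.in_arcsD1 H.in_arcsD2)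
    show "irrefl (parcs (G \<box> H))"
      using G.no_loops' H.no_loops' by (auto simp: cartesian_product_def irrefl_def)
    show "sym (parcs (G \<box> H))"
      using G.sym_arcs H.sym_arcs
      by (auto simp: cartesian_product_def sym_def symmetric_def)
  qed
qed

text \<open>
  The graphs are connected (symmetric and strongly connected), so shortest paths exist
  between any two vertices.
\<close>

lemma strongly_connected_complete:
  assumes "n > 0"
  shows "strongly_connected (with_proj (complete_graph n))"
proof -
  interpret pair_graph "complete_graph n" by (rule pair_graph_complete)
  have "u \<rightarrow>\<^sup>*\<^bsub>with_proj (complete_graph n)\<^esub> v" if "u < n" "v < n" for u v
  proof (cases "u = v")
    case True
    have "v \<in> verts (with_proj (complete_graph n))" using that by (simp add: complete_graph_def)
    with True show ?thesis by simp
  next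
    case False
    with that have "(u, v) \<in> parcs (complete_graph n)" by (simp add: complete_graph_def)
    then show ?thesis by (intro reachable_adjI) simp
  qed
  with assms show ?thesis by (auto simp: strongly_connected_def complete_graph_def)
qed

lemma strongly_connected_cone: "strongly_connected (with_proj (cone_graph k n))"
proof -
  let ?G = "with_proj (cone_graph k n)"
  interpret pair_graph "cone_graph k n" by (rule pair_graph_cone)
  have *: "Apex \<rightarrow>\<^sup>*\<^bsub>?G\<^esub> v" "v \<rightarrow>\<^sup>*\<^bsub>?G\<^esub> Apex" if "v \<in> pverts (cone_graph k n)" for v
  proof -
    have "v = Apex \<or> (Apex, v) \<in> parcs (cone_graph k n) \<and> (v, Apex) \<in> parcs (cone_graph k n)"
      using that by (auto simp: cone_graph_def Let_def)
    with that show "Apex \<rightarrow>\<^sup>*\<^bsub>?G\<^esub> v" "v \<rightarrow>\<^sup>*\<^bsub>?G\<^esub> Apex"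
      using reachable_adjI by auto
  qed
  show ?thesis
  proof (rule strongly_connectedI)
    show "verts ?G \<noteq> {}" by (simp add: cone_graph_def)
  qed (metis * reachable_trans with_proj_simps(1))
qed

lemma strongly_connected_cartesian:
  assumes "pair_graph G" "pair_graph H"
    and "strongly_connected (with_proj G)" "strongly_connected (with_proj H)"
  shows "strongly_connected (with_proj (G \<box> H))"
proof -
  interpret G: pair_graph G by fact
  interpret H: pair_graph H by fact
  interpret P: pair_graph "G \<box> H" by (rule pair_graph_cartesian) fact+
  have 1: "(g, h) \<rightarrow>\<^sup>*\<^bsub>with_proj (G \<box> H)\<^esub> (g', h)"
    if "g \<rightarrow>\<^sup>*\<^bsub>with_proj G\<^esub> g'" "h \<in> pverts H" for g g' h
    using that(1)
  proof (induction rule: G.reachable_induct)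
    case base
    with that(2) have "(g, h) \<in> verts (with_proj (G \<box> H))" by (simp add: cartesian_product_def)
    then show ?case by simp
  next
    case (step x y)
    have "(x, h) \<rightarrow>\<^bsub>with_proj (G \<box> H)\<^esub> (y, h)"
      using step that(2) by (simp add: cartesian_product_def)
    with step.IH show ?case by (rule wf_digraph.reachable_adj_trans[OF P.wf_digraph])
  qed
  have 2: "(g, h) \<rightarrow>\<^sup>*\<^bsub>with_proj (G \<box> H)\<^esub> (g, h')"
    if "h \<rightarrow>\<^sup>*\<^bsub>with_proj H\<^esub> h'" "g \<in> pverts G" for g h h'
    using that(1)
  proof (induction rule: H.reachable_induct)
    case base
    with that(2) have "(g, h) \<in> verts (with_proj (G \<box> H))" by (simp add: cartesian_product_def)
    then show ?case by simp
  next
    case (step x y)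
    have "(g, x) \<rightarrow>\<^bsub>with_proj (G \<box> H)\<^esub> (g, y)"
      using step that(2) by (simp add: cartesian_product_def)
    with step.IH show ?case by (rule wf_digraph.reachable_adj_trans[OF P.wf_digraph])
  qed
  show ?thesis
  proof (rule strongly_connectedI)
    show "verts (with_proj (G \<box> H)) \<noteq> {}"
      using assms(3,4) by (auto simp: strongly_connected_def cartesian_product_def)
  next
    fix u v assume "u \<in> verts (with_proj (G \<box> H))" "v \<in> verts (with_proj (G \<box> H))"
    then obtain g h g' h' where "u = (g, h)" "v = (g', h')"
      and "g \<in> pverts G" "g' \<in> pverts G" "h \<in> pverts H" "h' \<in> pverts H"
      by (auto simp: cartesian_product_def)
    with assms(3,4) show "u \<rightarrow>\<^sup>*\<^bsub>with_proj (G \<box> H)\<^esub> v"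
      using P.reachable_trans[OF 1[of g g' h] 2[of h h' g']] by (auto simp: strongly_connected_def)
  qed
qed

end

theory Submission
  imports Defs
begin

text \<open>
  Every vertex of the cone is at distance at most two from every other one, and a middle vertex
  lies inside a shortest path only if that path joins the two original vertices next to it. Hence
  a strong geodetic set containing \<open>a\<close> original vertices leaves at most \<open>a choose 2\<close> middle
  vertices out, and for \<open>k \<ge> 4\<close> the resulting bound is smallest at \<open>a = k\<close>. In the product with
  \<open>K\<^sub>n\<close>, each edge of \<open>K\<^sub>k\<close> provides \<open>n\<^sup>2\<close> pairs of copies of its ends, exactly
  as many as there are copies of its \<open>n\<close> middle vertices. One copy of the apex, joined to the
  copies of an original vertex, covers the other copies of the apex.
\<close>

section \<open>Shortest paths of length at most three\<close>

lemma shortest_vpath_1: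
  assumes "pair_graph G" "(x, y) \<in> parcs G"
  shows "shortest_vpath G x y [x, y]"
proof -
  interpret pair_graph G by fact
  have "x \<in> pverts G" "y \<in> pverts G" "x \<noteq> y"
    using assms(2) in_arcsD1 in_arcsD2 no_loops' by auto
  moreover have "2 \<le> length q" if "vpath q (with_proj G)" "hd q = x" "last q = y" for q
    using that \<open>x \<noteq> y\<close> by (cases q rule: vwalk_arcs.cases) (auto simp: vpath_def vwalk_def)
  ultimately show ?thesis
    using assms(2) by (force simp: shortest_vpath_def vpath_def vwalk_def)
qed

lemma shortest_vpath_2:
  assumes "pair_graph G" "(x, z) \<in> parcs G" "(z, y) \<in> parcs G" "x \<noteq> y" "(x, y) \<notin> parcs G"
  shows "shortest_vpath G x y [x, z, y]"
proof -
  interpret pair_graph G by fact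
  have "x \<in> pverts G" "y \<in> pverts G" "z \<in> pverts G" "x \<noteq> z" "z \<noteq> y"
    using assms(2,3) in_arcsD1 in_arcsD2 no_loops' by auto
  moreover have "3 \<le> length q" if "vpath q (with_proj G)" "hd q = x" "last q = y" for q
  proof (rule ccontr)
    assume "\<not> 3 \<le> length q"
    then have "length q = 0 \<or> length q = 1 \<or> length q = 2" by arith
    then show False
      using that assms(4,5) by (auto simp: vpath_def vwalk_def length_Suc_conv numeral_2_eq_2)
  qed
  ultimately show ?thesis
    using assms by (force simp: shortest_vpath_def vpath_def vwalk_def)
qed

lemma shortest_vpath_3:
  assumes "pair_graph G" "(x, w) \<in> parcs G" "(w, z) \<in> parcs G" "(z, y) \<in> parcs G"
    and "x \<noteq> y" "(x, y) \<notin> parcs G" "\<And>v. (x, v) \<in> parcs G \<Longrightarrow> (v, y) \<notin> parcs G"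
  shows "shortest_vpath G x y [x, w, z, y]"
proof -
  interpret pair_graph G by fact
  have "x \<in> pverts G" "y \<in> pverts G" "z \<in> pverts G" "w \<in> pverts G"
    "x \<noteq> w" "w \<noteq> z" "z \<noteq> y"
    using assms(2-4) in_arcsD1 in_arcsD2 no_loops' by auto
  moreover have "x \<noteq> z" "w \<noteq> y" using assms by auto
  moreover have "4 \<le> length q" if "vpath q (with_proj G)" "hd q = x" "last q = y" for q
  proof (rule ccontr)
    assume "\<not> 4 \<le> length q"
    then have "length q = 0 \<or> length q = 1 \<or> length q = 2 \<or> length q = 3" by arith
    then show False
      using that assms(5-7)
      by (auto simp: vpath_def vwalk_def length_Suc_conv numeral_2_eq_2 numeral_3_eq_3)
  qed
  ultimately show ?thesis
    using assms by (force simp: shortest_vpath_def vpath_def vwalk_def)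
qed

text \<open>The path through \<open>c\<close> witnesses distance at most two, so \<open>p\<close>
  has at most three vertices and an inner vertex can only be the middle one. An arc from
  \<open>x\<close> to \<open>y\<close> would then give a shorter path.\<close>

lemma shortest_vpath_inner:
  assumes "shortest_vpath G x y p" "vpath [x, c, y] (with_proj G)"
    and "v \<in> set p" "v \<noteq> x" "v \<noteq> y"
  shows "p = [x, v, y] \<and> (x, v) \<in> parcs G \<and> (v, y) \<in> parcs G \<and> (x, y) \<notin> parcs G"
proof -
  have p: "vpath p (with_proj G)" "hd p = x" "last p = y"
    and min: "\<And>q. vpath q (with_proj G) \<Longrightarrow> hd q = x \<Longrightarrow> last q = y \<Longrightarrow>
      length p - 1 \<le> length q - 1"
    using assms(1) by (auto simp: shortest_vpath_def)
  have "length p \<le> 3" using min[OF assms(2)] by simp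
  then have "length p = 0 \<or> length p = 1 \<or> length p = 2 \<or> length p = 3" by arith
  then have *: "p = [x, v, y]" "(x, v) \<in> parcs G" "(v, y) \<in> parcs G"
    using p assms(3-5)
    by (auto simp: vpath_def vwalk_def length_Suc_conv numeral_2_eq_2 numeral_3_eq_3)
  have "(x, y) \<notin> parcs G"
  proof
    assume "(x, y) \<in> parcs G"
    then have "vpath [x, y] (with_proj G)" using p * by (auto simp: vpath_def vwalk_def)
    from min[OF this] show False using * by simp
  qed
  with * show ?thesis by simp
qed

section \<open>Existence of shortest paths and a sufficient condition for strong geodetic
  sets\<close>

lemma shortest_vpath_exists:
  assumes "pair_graph G" "strongly_connected (with_proj G)" "x \<in> pverts G" "y \<in> pverts G"
  shows "\<exists>p. shortest_vpath G x y p"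
proof -
  interpret pair_graph G by fact
  have "x \<rightarrow>\<^sup>*\<^bsub>with_proj G\<^esub> y" using assms(2-4) by (auto simp: strongly_connected_def)
  then obtain p where "vpath p (with_proj G) \<and> hd p = x \<and> last p = y"
    using reachable_vpath_conv by auto
  from ex_has_least_nat[where m = vwalk_length and P =
      "\<lambda>p. vpath p (with_proj G) \<and> hd p = x \<and> last p = y", OF this]
  show ?thesis unfolding shortest_vpath_def by blast
qed

lemma shortest_vpath_ends:
  assumes "shortest_vpath G x y p"
  shows "x \<in> set p" "y \<in> set p" "set p \<subseteq> pverts G"
  using assms by (auto simp: shortest_vpath_def vpath_def vwalk_def)

text \<open>Injectivity of \<open>f\<close> means that each pair has at most one outside vertex to
  cover, so its path can be chosen through that vertex; all other pairs receive an arbitrary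
  shortest path. Vertices of \<open>S\<close> are covered as ends, which is why each needs a partner
  in \<open>S\<close>.\<close>

lemma strong_geodetic_setI:
  assumes G: "pair_graph G" "strongly_connected (with_proj G)"
    and S: "S \<subseteq> pverts G" "\<And>x. x \<in> S \<Longrightarrow> \<exists>y\<in>S. y \<noteq> x"
    and inj: "inj_on f (pverts G - S)"
    and cov: "\<And>v. v \<in> pverts G - S \<Longrightarrow> \<exists>x\<in>S. \<exists>y\<in>S. x \<noteq> y \<and> f v = {x, y} \<and>
      (\<exists>p. shortest_vpath G x y p \<and> v \<in> set p)"
  shows "strong_geodetic_set G S"
proof -
  define E where "E = {{x, y} |x y. x \<in> S \<and> y \<in> S \<and> x \<noteq> y}"
  have EI: "{x, y} \<in> E" if "x \<in> S" "y \<in> S" "x \<noteq> y" for x y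
    using that by (auto simp: E_def)
  \<comment> \<open>The ends are quantified because a pair \<open>e\<close> carries no orientation;
    this later becomes the disjunction in the definition of a strong geodetic set.\<close>
  let ?J = "\<lambda>e p. \<exists>x y. e = {x, y} \<and> shortest_vpath G x y p"
  have "\<exists>p. ?J e p \<and> (\<forall>v\<in>pverts G - S. f v = e \<longrightarrow> v \<in> set p)" if e: "e \<in> E" for e
  proof (cases "\<exists>v\<in>pverts G - S. f v = e")
    case True
    then obtain v where v: "v \<in> pverts G - S" "f v = e" by auto
    then have u: "u = v" if "u \<in> pverts G - S" "f u = e" for u using inj that by (auto simp: inj_on_def)
    obtain x y p where "f v = {x, y}" "shortest_vpath G x y p" "v \<in> set p"
      using cov[OF v(1)] by blast
    with u v(2) have "?J e p" "\<forall>u\<in>pverts G - S. f u = e \<longrightarrow> u \<in> set p" by blast+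
    then show ?thesis by blast
  next
    case False
    moreover obtain x y where "e = {x, y}" "x \<in> pverts G" "y \<in> pverts G"
      using e S(1) unfolding E_def by blast
    ultimately show ?thesis using shortest_vpath_exists[OF G, of x y] by blast
  qed
  then have "\<forall>e\<in>E. \<exists>p. ?J e p \<and> (\<forall>v\<in>pverts G - S. f v = e \<longrightarrow> v \<in> set p)" by (rule ballI)
  from bchoice[OF this] obtain P
    where *: "\<forall>e\<in>E. ?J e (P e) \<and> (\<forall>v\<in>pverts G - S. f v = e \<longrightarrow> v \<in> set (P e))" ..
  have P: "?J e (P e)" if "e \<in> E" for e using bspec[OF *] that by blast
  have P': "v \<in> set (P e)" if "e \<in> E" "v \<in> pverts G - S" "f v = e" for e v
    using bspec[OF *] that by blast
  have "shortest_vpath G x y (P {x, y}) \<or> shortest_vpath G y x (P {x, y})"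
    if "x \<in> S" "y \<in> S" "x \<noteq> y" for x y
    using P[OF EI[OF that]] by (auto simp: doubleton_eq_iff)
  moreover have "(\<Union>e\<in>E. set (P e)) = pverts G"
  proof (intro equalityI subsetI)
    fix v assume "v \<in> (\<Union>e\<in>E. set (P e))"
    then obtain e where e: "e \<in> E" "v \<in> set (P e)" by blast
    from P[OF e(1)] obtain x y where "shortest_vpath G x y (P e)" by blast
    from shortest_vpath_ends(3)[OF this] e(2) show "v \<in> pverts G" by blast
  next
    fix v assume v: "v \<in> pverts G"
    show "v \<in> (\<Union>e\<in>E. set (P e))"
    proof (cases "v \<in> S")
      case True
      with S(2) obtain y where "y \<in> S" "y \<noteq> v" by blast
      with True have e: "{v, y} \<in> E" by (intro EI) auto
      then have "v \<in> set (P {v, y})"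
        using P[OF e] shortest_vpath_ends(1,2) by (metis doubleton_eq_iff)
      with e show ?thesis by blast
    next
      case False
      with v obtain x y where "x \<in> S" "y \<in> S" "x \<noteq> y" "f v = {x, y}" using cov[of v] by blast
      then have "f v \<in> E" by (simp add: EI)
      with P'[of "f v" v] False v show ?thesis by blast
    qed
  qed
  ultimately show ?thesis using S(1) unfolding strong_geodetic_set_def E_def by blast
qed

section \<open>The cone\<close>

text \<open>The index set is a parameter because two choices occur: \<open>{..<n}\<close> gives all
  middle vertices, \<open>{1..<n}\<close> those in the optimal set.\<close>

definition mids :: "nat \<Rightarrow> nat set \<Rightarrow> sub_vert set" where
  "mids k L = {Mid i j l |i j l. i < j \<and> j < k \<and> l \<in> L}"

lemma Mid_in_mids [simp]: "Mid i j l \<in> mids k L \<longleftrightarrow> i < j \<and> j < k \<and> l \<in> L"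
  by (auto simp: mids_def)

lemma Orig_notin_mids [simp]: "Orig i \<notin> mids k L" and Apex_notin_mids [simp]: "Apex \<notin> mids k L"
  by (auto simp: mids_def)

lemma card_less_pairs: "finite {(i, j). i < j \<and> j < k} \<and> card {(i, j). i < j \<and> j < k} = k choose 2"
  for k :: nat
proof (induction k)
  case (Suc k)
  have *: "{(i, j). i < j \<and> j < Suc k} = {(i, j). i < j \<and> j < k} \<union> (\<lambda>i. (i, k)) ` {..<k}"
    by auto
  have "card ((\<lambda>i. (i, k)) ` {..<k}) = k" by (simp add: card_image inj_on_def)
  moreover have "{(i, j). i < j \<and> j < k} \<inter> (\<lambda>i. (i, k)) ` {..<k} = {}" by auto
  ultimately show ?case
    using Suc unfolding * by (simp add: card_Un_disjoint numeral_2_eq_2)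
qed simp

lemma card_mids:
  assumes "finite L"
  shows "finite (mids k L)" "card (mids k L) = (k choose 2) * card L"
proof -
  let ?D = "{(i, j). i < j \<and> j < k} \<times> L"
  have *: "mids k L = (\<lambda>((i, j), l). Mid i j l) ` ?D"
    by (auto simp: mids_def image_iff)
  have "inj_on (\<lambda>((i, j), l). Mid i j l) ?D" by (auto simp: inj_on_def)
  then show "finite (mids k L)" "card (mids k L) = (k choose 2) * card L"
    using assms card_less_pairs[of k] unfolding * by (auto simp: card_image card_cartesian_product)
qed

lemma pverts_cone: "pverts (cone_graph k n) = insert Apex (Orig ` {..<k} \<union> mids k {..<n})"
  by (auto simp: cone_graph_def sub_verts_def mids_def)

lemma cone_adj [simp]:
  "(Orig i, Orig j) \<notin> parcs (cone_graph k n)"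
  "(Mid a b c, Mid a' b' c') \<notin> parcs (cone_graph k n)"
  "(Orig a, Mid i j l) \<in> parcs (cone_graph k n) \<longleftrightarrow> i < j \<and> j < k \<and> l < n \<and> (a = i \<or> a = j)"
  "(Mid i j l, Orig a) \<in> parcs (cone_graph k n) \<longleftrightarrow> i < j \<and> j < k \<and> l < n \<and> (a = i \<or> a = j)"
  "(Apex, Orig i) \<in> parcs (cone_graph k n) \<longleftrightarrow> i < k"
  "(Orig i, Apex) \<in> parcs (cone_graph k n) \<longleftrightarrow> i < k"
  "(Apex, Mid i j l) \<in> parcs (cone_graph k n) \<longleftrightarrow> i < j \<and> j < k \<and> l < n"
  "(Mid i j l, Apex) \<in> parcs (cone_graph k n) \<longleftrightarrow> i < j \<and> j < k \<and> l < n"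
  "(Apex, Apex) \<notin> parcs (cone_graph k n)"
  by (auto simp: cone_graph_def sub_arcs_def sub_verts_def Let_def)

text \<open>The apex keeps all distances at most two, so the middle vertex sits between two of its
  neighbours, which are \<open>Orig i\<close>, \<open>Orig j\<close> and \<open>Apex\<close>.
  \<open>Apex\<close> cannot be an end, being adjacent to every other vertex. The vertex set of
  \<open>p\<close> is independent of the direction in which the path is listed.\<close>

lemma Mid_in_shortest_vpath:
  assumes "shortest_vpath (cone_graph k n) x y p" "Mid i j l \<in> set p"
    and "Mid i j l \<noteq> x" "Mid i j l \<noteq> y"
  shows "{x, y} = {Orig i, Orig j} \<and> set p = {Orig i, Mid i j l, Orig j}"
proof -
  let ?G = "cone_graph k n"
  have xy: "x \<in> pverts ?G" "y \<in> pverts ?G"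
    using shortest_vpath_ends[OF assms(1)] by auto
  have "x \<noteq> y"
  proof
    assume "x = y"
    moreover from this have "vpath [x] (with_proj ?G)" using xy by (auto simp: vpath_def vwalk_def)
    ultimately have "length p - 1 \<le> 0" using assms(1)
      by (auto simp: shortest_vpath_def dest!: spec[of _ "[x]"])
    moreover have "x \<in> set p" using shortest_vpath_ends[OF assms(1)] by simp
    ultimately show False using assms(2,3) by (cases p) auto
  qed
  have "\<exists>c. vpath [x, c, y] (with_proj ?G)"
  proof (cases "x = Apex \<or> y = Apex")
    case False
    then have "vpath [x, Apex, y] (with_proj ?G)"
      using xy \<open>x \<noteq> y\<close> by (auto simp: vpath_def vwalk_def pverts_cone mids_def)
    then show ?thesis ..
  next
    \<comment> \<open>With the apex as an end the shortest path is a single edge and has no room for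
      the middle vertex, so this case is contradictory.\<close>
    case True
    then have "(x, y) \<in> parcs ?G" using xy \<open>x \<noteq> y\<close> by (auto simp: pverts_cone mids_def)
    then have "vpath [x, y] (with_proj ?G)" using xy \<open>x \<noteq> y\<close> by (auto simp: vpath_def vwalk_def)
    then have "length p - 1 \<le> 1" using assms(1)
      by (auto simp: shortest_vpath_def dest!: spec[of _ "[x, y]"])
    moreover have "hd p = x" "last p = y" using assms(1) by (auto simp: shortest_vpath_def)
    ultimately have False
      using assms(2-4) by (cases p rule: vwalk_arcs.cases) auto
    then show ?thesis ..
  qed
  then obtain c where "vpath [x, c, y] (with_proj ?G)" ..
  from shortest_vpath_inner[OF assms(1) this assms(2-4)]
  have p: "p = [x, Mid i j l, y]" "(x, Mid i j l) \<in> parcs ?G" "(Mid i j l, y) \<in> parcs ?G"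
    "(x, y) \<notin> parcs ?G"
    by auto
  have "x \<in> {Orig i, Orig j, Apex}" using p(2) by (cases x) auto
  moreover have "y \<in> {Orig i, Orig j, Apex}" using p(3) by (cases y) auto
  ultimately have "{x, y} = {Orig i, Orig j}"
    using p(2-4) \<open>x \<noteq> y\<close> by auto
  with p(1) show ?thesis by auto
qed

section \<open>Lower bound for the cone\<close>

lemma choose_two_bound:
  assumes "4 \<le> k" "a \<le> k"
  shows "k + (a choose 2) \<le> a + (k choose 2)"
proof -
  obtain d where k: "k = a + d" using assms(2) le_Suc_ex by blast
  have two: "2 * (m choose 2) + m = m * m" for m :: nat
    by (induction m) (auto simp: numeral_2_eq_2)
  \<comment> \<open>Since twice \<open>m choose 2\<close> is \<open>m * m - m\<close>, doubling
    turns the claim into \<open>3 * d <= k * k - a * a\<close>. The right side is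
    \<open>d * (2 * a + d)\<close>, and \<open>2 * a + d = k + a\<close> is at least 4.\<close>
  have "d * 3 \<le> d * (2 * a + d)" if "d \<noteq> 0"
    using that assms(1) k by (intro mult_le_mono2) linarith
  moreover have "k * k = a * a + d * (2 * a + d)" by (simp add: k algebra_simps)
  ultimately show ?thesis using two[of k] two[of a] k by (cases "d = 0") (simp, linarith)
qed

lemma cone_lower_bound:
  assumes "4 \<le> k" "strong_geodetic_set (cone_graph k n) S" "1 \<le> n"
  shows "(k choose 2) * (n - 1) + k \<le> card S"
proof -
  let ?G = "cone_graph k n" and ?M = "mids k {..<n}"
  from assms(2) obtain P where S: "S \<subseteq> pverts ?G"
    and P: "\<forall>x\<in>S. \<forall>y\<in>S. x \<noteq> y \<longrightarrow>
        shortest_vpath ?G x y (P {x, y}) \<or> shortest_vpath ?G y x (P {x, y})"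
    and cov: "(\<Union>e\<in>{{x, y} |x y. x \<in> S \<and> y \<in> S \<and> x \<noteq> y}. set (P e)) = pverts ?G"
    unfolding strong_geodetic_set_def by (elim conjE exE) (rule that)
  define A where "A = {i. i < k \<and> Orig i \<in> S}"
  have A: "finite A" "A \<subseteq> {..<k}" by (auto simp: A_def)
  have cA: "card A \<le> k" using card_mono[OF _ A(2)] by simp
  \<comment> \<open>A middle vertex outside \<open>S\<close> is no end of a chosen path, so it lies
    inside one; that path must be the one of its two original neighbours, and it has no further
    inner vertex.\<close>
  have uncovered: "Orig i \<in> S \<and> Orig j \<in> S \<and> set (P {Orig i, Orig j}) = {Orig i, Mid i j l, Orig j}"
    if "Mid i j l \<in> ?M - S" for i j l
  proof -
    have "Mid i j l \<in> pverts ?G" using that by (simp add: pverts_cone)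
    then obtain x y where xy: "x \<in> S" "y \<in> S" "x \<noteq> y" "Mid i j l \<in> set (P {x, y})"
      using cov by blast
    have "shortest_vpath ?G x y (P {x, y}) \<or> shortest_vpath ?G y x (P {x, y})"
      using P xy(1-3) by simp
    moreover have "Mid i j l \<noteq> x" "Mid i j l \<noteq> y" using that xy by auto
    ultimately have eq: "{x, y} = {Orig i, Orig j}"
      and "set (P {x, y}) = {Orig i, Mid i j l, Orig j}"
      using Mid_in_shortest_vpath[of k n x y "P {x, y}" i j l]
        Mid_in_shortest_vpath[of k n y x "P {x, y}" i j l] xy(4)
      by (auto simp: insert_commute)
    moreover have "{Orig i, Orig j} \<subseteq> S" unfolding eq[symmetric] using xy(1,2) by simp
    ultimately show ?thesis by (simp only: eq) simp
  qed
  \<comment> \<open>Each middle vertex outside \<open>S\<close> is charged to the edge of the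
    complete graph on which it lies; the default \<open>{}\<close> is never reached on
    \<open>?M - S\<close>.\<close>
  let ?g = "\<lambda>v. case v of Mid i j l \<Rightarrow> {i, j} | _ \<Rightarrow> {}"
  have "inj_on ?g (?M - S)"
  proof (rule inj_onI)
    fix u v assume uv: "u \<in> ?M - S" "v \<in> ?M - S" "?g u = ?g v"
    then obtain i j l i' j' l' where e: "u = Mid i j l" "v = Mid i' j' l'" "i < j" "i' < j'"
      by (auto simp: mids_def)
    with uv(3) have "i = i'" "j = j'" by (auto simp: doubleton_eq_iff)
    \<comment> \<open>Both vertices are the inner vertex of the one path chosen for the same pair,
      hence equal.\<close>
    with e uncovered[of i j l] uncovered[of i j l'] uv(1,2) show "u = v" by auto
  qed
  moreover have "?g ` (?M - S) \<subseteq> {B. B \<subseteq> A \<and> card B = 2}"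
  proof (rule image_subsetI)
    fix u assume u: "u \<in> ?M - S"
    then obtain i j l where "u = Mid i j l" "i < j" "j < k" by (auto simp: mids_def)
    with u uncovered[of i j l] show "?g u \<in> {B. B \<subseteq> A \<and> card B = 2}" by (auto simp: A_def)
  qed
  moreover have "finite {B. B \<subseteq> A \<and> card B = 2}" using A(1) by simp
  ultimately have "card (?M - S) \<le> card {B. B \<subseteq> A \<and> card B = 2}" by (rule card_inj_on_le)
  then have left: "card (?M - S) \<le> card A choose 2" by (simp add: n_subsets[OF A(1)])
  have fin: "finite S"
    using S card_mids(1)[of "{..<n}" k] by (auto simp: pverts_cone intro: finite_subset)
  \<comment> \<open>With \<open>a = card A\<close>, the set has at least
    \<open>a + (k choose 2) * n - (a choose 2)\<close> elements, and \<open>choose_two_bound\<close>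
    replaces \<open>a\<close> by \<open>k\<close>.\<close>
  have "card (?M \<inter> S) + card (?M - S) = (k choose 2) * n"
    using card_mids[of "{..<n}" k] card_Int_Diff[of ?M S] by simp
  moreover have "card A + card (?M \<inter> S) \<le> card S"
  proof -
    have "card A = card (Orig ` A)" by (simp add: card_image inj_on_def)
    also have "\<dots> + card (?M \<inter> S) = card (Orig ` A \<union> (?M \<inter> S))"
      using A(1) fin by (intro card_Un_disjoint[symmetric]) auto
    also have "\<dots> \<le> card S" using fin by (intro card_mono) (auto simp: A_def)
    finally show ?thesis .
  qed
  moreover have "k + (card A choose 2) \<le> card A + (k choose 2)"
    using choose_two_bound assms(1) cA by blast
  \<comment> \<open>Subtraction is truncated here; \<open>1 <= n\<close> makes it exact, as the next
    fact records.\<close>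
  moreover have "(k choose 2) * (n - 1) = (k choose 2) * n - (k choose 2)"
    by (simp add: diff_mult_distrib2)
  moreover have "(k choose 2) \<le> (k choose 2) * n" using assms(3) by simp
  ultimately show ?thesis using left by linarith
qed

section \<open>An optimal set in the cone\<close>

lemma cone_upper_bound:
  assumes "4 \<le> k" "2 \<le> n"
  shows "\<exists>S. finite S \<and> strong_geodetic_set (cone_graph k n) S \<and> card S = (k choose 2) * (n - 1) + k"
proof -
  let ?G = "cone_graph k n"
  let ?S = "Orig ` {..<k} \<union> mids k {1..<n}"
  let ?f = "\<lambda>v. case v of Mid i j l \<Rightarrow> {Orig i, Orig j} | _ \<Rightarrow> {Orig 0, Mid 1 2 1}"
  have G: "pair_graph ?G" by (rule pair_graph_cone)
  have out: "v = Apex \<or> (\<exists>i j. v = Mid i j 0 \<and> i < j \<and> j < k)" if "v \<in> pverts ?G - ?S" for v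
    using that by (cases v) (auto simp: pverts_cone)
  have "strong_geodetic_set ?G ?S"
  proof (rule strong_geodetic_setI[OF G strongly_connected_cone, where f = ?f])
    show "?S \<subseteq> pverts ?G" by (auto simp: pverts_cone mids_def)
  next
    fix x assume "x \<in> ?S"
    have "Orig 0 \<in> ?S" "Orig 1 \<in> ?S" using assms by auto
    then show "\<exists>y\<in>?S. y \<noteq> x" by (cases "x = Orig 0") (auto intro: bexI[of _ "Orig 0"])
  next
    show "inj_on ?f (pverts ?G - ?S)"
    proof (rule inj_onI)
      fix u v assume "u \<in> pverts ?G - ?S" "v \<in> pverts ?G - ?S" "?f u = ?f v"
      with out[of u] out[of v] show "u = v" by (auto simp: doubleton_eq_iff)
    qed
  next
    fix v assume "v \<in> pverts ?G - ?S"
    from out[OF this] show "\<exists>x\<in>?S. \<exists>y\<in>?S. x \<noteq> y \<and> ?f v = {x, y} \<and>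
      (\<exists>p. shortest_vpath ?G x y p \<and> v \<in> set p)"
    proof (elim disjE exE conjE)
      assume v: "v = Apex"
      have "shortest_vpath ?G (Orig 0) (Mid 1 2 1) [Orig 0, Apex, Mid 1 2 1]"
        using assms by (intro shortest_vpath_2[OF G]) auto
      moreover have "Orig 0 \<in> ?S" "Mid 1 2 1 \<in> ?S" using assms by auto
      ultimately show ?thesis
        by (intro bexI[of _ "Orig 0"] bexI[of _ "Mid 1 2 1"]) (auto simp: v)
    next
      fix i j assume v: "v = Mid i j 0" "i < j" "j < k"
      then have "shortest_vpath ?G (Orig i) (Orig j) [Orig i, v, Orig j]"
        using assms by (intro shortest_vpath_2[OF G]) auto
      with v show ?thesis
        by (intro bexI[of _ "Orig i"] bexI[of _ "Orig j"]) auto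
    qed
  qed
  moreover have "card ?S = (k choose 2) * (n - 1) + k"
  proof -
    have "card ?S = card (Orig ` {..<k}) + card (mids k {1..<n})"
      by (intro card_Un_disjoint) (auto simp: card_mids)
    then show ?thesis by (simp add: card_mids card_image inj_on_def)
  qed
  moreover have "finite ?S" by (simp add: card_mids)
  ultimately show ?thesis by blast
qed

section \<open>The product with a complete graph\<close>

lemma cone_complete_adj:
  "((u, a), (v, b)) \<in> parcs (cone_graph k n \<box> complete_graph m) \<longleftrightarrow>
     u = v \<and> u \<in> pverts (cone_graph k n) \<and> a < m \<and> b < m \<and> a \<noteq> b \<or>
     a = b \<and> a < m \<and> (u, v) \<in> parcs (cone_graph k n)"
  by (auto simp: cartesian_product_def complete_graph_def)

lemma product_upper_bound:
  assumes "4 \<le> k" "2 \<le> n"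
  shows "\<exists>S. finite S \<and> strong_geodetic_set (cone_graph k n \<box> complete_graph n) S \<and> card S = k * n + 1"
proof -
  let ?G = "cone_graph k n \<box> complete_graph n"
  let ?S = "insert (Apex, 0) (Orig ` {..<k} \<times> {..<n})"
  \<comment> \<open>Position \<open>h\<close> of the copy and index \<open>l\<close> of the middle vertex both range over \<open>n\<close> values, so
    \<open>l\<close> can serve as the position of the second end vertex.\<close>
  let ?f = "\<lambda>(v, h). case v of Mid i j l \<Rightarrow> {(Orig i, h), (Orig j, l)}
    | _ \<Rightarrow> {(Apex, 0), (Orig 0, h)}"
  have G: "pair_graph ?G"
    by (intro pair_graph_cartesian pair_graph_cone pair_graph_complete)
  have conn: "strongly_connected (with_proj ?G)"
    using assms by (intro strongly_connected_cartesian pair_graph_cone pair_graph_complete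
        strongly_connected_cone strongly_connected_complete) simp
  have V: "pverts ?G = pverts (cone_graph k n) \<times> {..<n}"
    by (simp add: cartesian_product_def complete_graph_def)
  have out: "(\<exists>h. v = (Apex, h) \<and> 0 < h \<and> h < n) \<or>
      (\<exists>i j l h. v = (Mid i j l, h) \<and> i < j \<and> j < k \<and> l < n \<and> h < n)"
    if "v \<in> pverts ?G - ?S" for v
    using that by (auto simp: V pverts_cone mids_def)
  have "strong_geodetic_set ?G ?S"
  proof (rule strong_geodetic_setI[OF G conn, where f = ?f])
    show "?S \<subseteq> pverts ?G" using assms by (auto simp: V pverts_cone)
  next
    fix x assume "x \<in> ?S"
    have "(Orig 0, 0) \<in> ?S" "(Apex, 0) \<in> ?S" using assms by auto
    then show "\<exists>y\<in>?S. y \<noteq> x" by (metis Pair_inject sub_vert.distinct(3))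
  next
    show "inj_on ?f (pverts ?G - ?S)"
    proof (rule inj_onI)
      fix u v assume "u \<in> pverts ?G - ?S" "v \<in> pverts ?G - ?S" "?f u = ?f v"
      \<comment> \<open>Pairs assigned to copies of the apex contain \<open>(Apex, 0)\<close>. In
        the other pairs \<open>i < j\<close> tells the two ends apart, so \<open>h\<close> and
        \<open>l\<close> can be read off.\<close>
      with out[of u] out[of v] show "u = v" by (auto simp: doubleton_eq_iff)
    qed
  next
    fix v assume "v \<in> pverts ?G - ?S"
    from out[OF this] show "\<exists>x\<in>?S. \<exists>y\<in>?S. x \<noteq> y \<and> ?f v = {x, y} \<and>
      (\<exists>p. shortest_vpath ?G x y p \<and> v \<in> set p)"
    proof (elim disjE exE conjE)
      fix h assume v: "v = (Apex, h)" "0 < h" "h < n"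
      \<comment> \<open>Both coordinates change, so the distance is two; changing the copy first
        leads through \<open>(Apex, h)\<close> instead of \<open>(Orig 0, 0)\<close>.\<close>
      then have "shortest_vpath ?G (Apex, 0) (Orig 0, h) [(Apex, 0), v, (Orig 0, h)]"
        using assms by (intro shortest_vpath_2[OF G]) (auto simp: cone_complete_adj pverts_cone)
      moreover have "(Apex, 0) \<in> ?S" "(Orig 0, h) \<in> ?S" using assms v by auto
      ultimately show ?thesis
        by (intro bexI[of _ "(Apex, 0)"] bexI[of _ "(Orig 0, h)"]) (auto simp: v)
    next
      fix i j l h assume v: "v = (Mid i j l, h)" "i < j" "j < k" "l < n" "h < n"
      have "\<exists>p. shortest_vpath ?G (Orig i, h) (Orig j, l) p \<and> v \<in> set p"
      \<comment> \<open>Within one copy the distance is two. Otherwise the path goes to the middle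
        vertex in copy \<open>h\<close>, switches to copy \<open>l\<close> there, and then reaches
        \<open>Orig j\<close>.\<close>
      proof (cases "h = l")
        case True
        have "shortest_vpath ?G (Orig i, h) (Orig j, l) [(Orig i, h), v, (Orig j, l)]"
          using v True by (intro shortest_vpath_2[OF G]) (auto simp: cone_complete_adj)
        then show ?thesis by auto
      next
        case False
        have "shortest_vpath ?G (Orig i, h) (Orig j, l)
            [(Orig i, h), v, (Mid i j l, l), (Orig j, l)]"
        proof (rule shortest_vpath_3[OF G])
          \<comment> \<open>Two steps would have to be one change of copy and one cone edge from
            \<open>Orig i\<close> to \<open>Orig j\<close>, but original vertices are never
            adjacent.\<close>
          fix w assume "((Orig i, h), w) \<in> parcs ?G"
          then show "(w, (Orig j, l)) \<notin> parcs ?G"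
            using v(2) False by (cases w) (auto simp: cone_complete_adj)
        qed (use v False in \<open>auto simp: cone_complete_adj pverts_cone\<close>)
        then show ?thesis by auto
      qed
      with v show ?thesis
        by (intro bexI[of _ "(Orig i, h)"] bexI[of _ "(Orig j, l)"]) auto
    qed
  qed
  moreover have "card ?S = k * n + 1"
  proof -
    have "card ?S = Suc (card (Orig ` {..<k} \<times> {..<n}))" by (intro card_insert_disjoint) auto
    then show ?thesis by (simp add: card_cartesian_product card_image inj_on_def)
  qed
  moreover have "finite ?S" by simp
  ultimately show ?thesis by blast
qed

theorem theorem7p1:
  fixes k n :: nat
  assumes "k \<ge> 4" and "n \<ge> 2"
  shows "strong_geodetic_number (cone_graph k n) = (k choose 2) * (n - 1) + k \<and>
         strong_geodetic_number (cone_graph k n \<box> complete_graph n) \<le> k * n + 1"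
proof
  show "strong_geodetic_number (cone_graph k n) = (k choose 2) * (n - 1) + k"
    unfolding strong_geodetic_number_def
  proof (rule Least_equality)
    fix m assume "\<exists>S. finite S \<and> strong_geodetic_set (cone_graph k n) S \<and> card S = m"
    then show "(k choose 2) * (n - 1) + k \<le> m" using cone_lower_bound[OF assms(1)] assms(2) by auto
  qed (rule cone_upper_bound[OF assms])
  show "strong_geodetic_number (cone_graph k n \<box> complete_graph n) \<le> k * n + 1"
    unfolding strong_geodetic_number_def by (rule Least_le, rule product_upper_bound[OF assms])
qed

end
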